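(* $\text{HG}_s(\mathcal{P}etal)= 4s(s+1)-2$. More precisely, a) $\text{HG}_s(Pe_n) < 4s(s+1)-1$ for all $n$; b) $\text{HG}_s(Pe_n) = 4s(s+1)-2$ for large $n$.
   Context: Hat guessing game $\langle G, h, g\rangle$: a sage sits at each vertex $v$ of the graph $G$; an adversary puts on the head of each sage $v$ a hat whose color is chosen from $\{0,1,\dots,h(v)-1\}$; each sage sees the hat colors of his neighbours but not his own; without communication, each sage $v$ names a list of $g(v)$ colors, determined by a deterministic strategy (fixed in advance and known to the adversary) from the colors he sees. The game is winning if there is a strategy guaranteeing that for every hat assignment at least one sage's list contains his own hat color. For a graph $G$ and integer $s\ge 1$, $\text{HG}_s(G)$ is the maximal $k$ such that the game with $h$ constantly equal to $k$ and $g$ constantly equal to $s$ is winning. For a class $\mathcal{C}$ of graphs, $\text{HG}_s(\mathcal{C})=\sup\{\text{HG}_s(G): G\in\mathcal{C}\}$. The petal $Pe_n$ is the graph obtained from the path $P_n$ ($n\ge 1$ vertices) by adding a vertex (the stem) adjacent to every vertex of $P_n$; $\mathcal{P}etal$ is the class of all petals. *)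

theory Defs
  imports "Graph_Theory.Pair_Digraph" "HOL-Library.FuncSet" "HOL-Library.Extended_Nat"
begin

text \<open>Simple graphs are symmetric loop-free digraphs (locale \<^locale>\<open>pair_graph\<close>); an
  undirected edge is a pair of opposite arcs.\<close>

definition neighbours :: "'a pair_pre_digraph \<Rightarrow> 'a \<Rightarrow> 'a set" where
  "neighbours G v = {u. (v, u) \<in> parcs G}"

definition colourings :: "'a set \<Rightarrow> ('a \<Rightarrow> nat) \<Rightarrow> ('a \<Rightarrow> nat) set" where
  "colourings A h = (\<Pi>\<^sub>E v\<in>A. {..<h v})"

text \<open>A strategy maps a sage and a colouring of his neighbours to a list of guesses.
  Repetitions in a list are allowed; they never help the sage.\<close>

definition is_strategy ::
  "'a pair_pre_digraph \<Rightarrow> ('a \<Rightarrow> nat) \<Rightarrow> ('a \<Rightarrow> nat) \<Rightarrow> ('a \<Rightarrow> ('a \<Rightarrow> nat) \<Rightarrow> nat list) \<Rightarrow> bool" where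
  "is_strategy G h g \<sigma> \<longleftrightarrow>
     (\<forall>v\<in>pverts G. \<forall>c\<in>colourings (neighbours G v) h.
        length (\<sigma> v c) = g v \<and> set (\<sigma> v c) \<subseteq> {..<h v})"

definition hat_game_winning ::
  "'a pair_pre_digraph \<Rightarrow> ('a \<Rightarrow> nat) \<Rightarrow> ('a \<Rightarrow> nat) \<Rightarrow> bool" where
  "hat_game_winning G h g \<longleftrightarrow>
     (\<exists>\<sigma>. is_strategy G h g \<sigma> \<and>
        (\<forall>c\<in>colourings (pverts G) h.
           \<exists>v\<in>pverts G. c v \<in> set (\<sigma> v (restrict c (neighbours G v)))))"

text \<open>In \<^typ>\<open>enat\<close> a finite supremum of a nonempty set is attained, so this is the maximal
  winning \<open>k\<close> whenever such a maximum exists, and \<open>\<infinity>\<close> if the game is winning for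
  arbitrarily large \<open>k\<close>.\<close>

definition HG :: "nat \<Rightarrow> 'a pair_pre_digraph \<Rightarrow> enat" where
  "HG s G = (SUP k\<in>{k. hat_game_winning G (\<lambda>_. k) (\<lambda>_. s)}. enat k)"

definition HG_class :: "nat \<Rightarrow> 'a pair_pre_digraph set \<Rightarrow> enat" where
  "HG_class s C = (SUP G\<in>C. HG s G)"

definition path_graph :: "nat \<Rightarrow> nat pair_pre_digraph" where
  "path_graph n =
     \<lparr>pverts = {..<n}, parcs = {(i, j). i < n \<and> j < n \<and> (j = Suc i \<or> i = Suc j)}\<rparr>"

text \<open>\<^const>\<open>None\<close> is the new vertex.\<close>

definition add_stem :: "'a pair_pre_digraph \<Rightarrow> 'a option pair_pre_digraph" where
  "add_stem G =
     \<lparr>pverts = insert None (Some ` pverts G),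
      parcs = {(Some u, Some v) |u v. (u, v) \<in> parcs G}
            \<union> {(None, Some v) |v. v \<in> pverts G}
            \<union> {(Some v, None) |v. v \<in> pverts G}\<rparr>"

definition petal :: "nat \<Rightarrow> nat option pair_pre_digraph" where
  "petal n = add_stem (path_graph n)"

definition petals :: "nat option pair_pre_digraph set" where
  "petals = {petal n |n. n \<ge> 1}"

lemma pair_graph_petal: "pair_graph (petal n)"
proof
  show "finite (pverts (petal n))"
    by (simp add: petal_def add_stem_def path_graph_def)
  have "parcs (petal n) \<subseteq> pverts (petal n) \<times> pverts (petal n)"
    by (auto simp: petal_def add_stem_def path_graph_def)
  moreover have "finite (pverts (petal n) \<times> pverts (petal n))"
    by (simp add: petal_def add_stem_def path_graph_def)
  ultimately show "finite (parcs (petal n))"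
    by (rule finite_subset)
  show "symmetric (with_proj (petal n))"
    by (auto simp: symmetric_def sym_def petal_def add_stem_def path_graph_def
        arcs_ends_def arc_to_ends_def)
  show "\<And>e. e \<in> parcs (petal n) \<Longrightarrow> fst e \<in> pverts (petal n)"
    "\<And>e. e \<in> parcs (petal n) \<Longrightarrow> snd e \<in> pverts (petal n)"
    "\<And>e. e \<in> parcs (petal n) \<Longrightarrow> fst e \<noteq> snd e"
    by (auto simp: petal_def add_stem_def path_graph_def)
qed

end

theory Submission
  imports Defs
begin

text \<open>A fixed strategy on a petal is a family of path strategies, one for each stem colour, and
  the stem can correct exactly the path colourings on which at most \<open>s\<close> of them lose.  So the game
  is winning iff any \<open>s + 1\<close> of the path strategies win jointly, and jointly they make
  \<open>t = s (s + 1)\<close> guesses at each path vertex.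

  If \<open>k \<ge> 4 t - 1\<close>, walk along the path: for each colour of the next vertex, at least \<open>2 t\<close>
  colours of the current vertex extend to a colouring of the initial segment on which everybody
  loses, since double counting excludes at most \<open>k t / (2 t)\<close> colours.

  If \<open>k = 4 t - 2\<close>, the set of these colours can be kept to a cyclic arc in \<open>\<int>/k\<close> whose length
  drops by one at each vertex, because \<open>(k - m + 1) m \<le> k t\<close> for all \<open>m\<close>; hence \<open>t\<close> guesses win on
  a path of length \<open>k\<close>.  Each \<open>s + 1\<close> stem colours get their own segment of the long path, on
  which they share these \<open>t\<close> guesses.\<close>

section \<open>Games on a path\<close>

text \<open>The vertices of the path are \<open>1, \<dots>, n\<close>; the colours of \<open>0\<close> and \<open>n + 1\<close> are dummies that make
  the two ends uniform with the inner vertices.\<close>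

lemma path_losing:
  fixes G :: "nat \<Rightarrow> nat \<Rightarrow> nat \<Rightarrow> nat set"
  assumes G: "\<And>i l r. l < k \<Longrightarrow> r < k \<Longrightarrow> i \<in> {1..n} \<Longrightarrow> finite (G i l r) \<and> card (G i l r) \<le> t"
    and t: "t \<ge> 1" and k: "4 * t - 1 \<le> k"
  shows "\<exists>x. (\<forall>j. x j < k) \<and> (\<forall>i\<in>{1..n}. x i \<notin> G i (x (i - 1)) (x (i + 1)))"
proof -
  \<comment> \<open>Whether sage \<open>i\<close> is wrong depends on the colour of vertex
    \<open>i + 1\<close>, so the colours of \<open>i\<close> still open to the adversary are
    recorded relative to \<open>b\<close>.\<close>
  define N where "N i b = {a. a < k \<and> (\<exists>x. (\<forall>j. x j < k) \<and> x i = a \<and> x (i + 1) = b \<and>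
    (\<forall>j\<in>{1..i}. x j \<notin> G j (x (j - 1)) (x (j + 1))))}" for i b
  have finN: "finite (N i b)" for i b by (simp add: N_def)
  have main: "2 * t \<le> card (N i b)" if "i \<le> n" "b < k" for i b
    using that
  proof (induction i arbitrary: b)
    case 0
    have "N 0 b = {..<k}"
    proof -
      have "a \<in> N 0 b" if "a < k" for a
        using that 0 by (auto simp: N_def intro!: exI[of _ "\<lambda>j. if j = 0 then a else b"])
      then show ?thesis by (auto simp: N_def)
    qed
    then show ?case using k t by simp
  next
    case (Suc i)
    define B where "B = {..<k} - N (Suc i) b"
    have finB: "finite B" by (simp add: B_def)
    \<comment> \<open>A losing colouring through \<open>c\<close> and \<open>a\<close> can be
      recoloured at vertex \<open>i + 2\<close>, which sages 1 to \<open>i\<close> do not see. So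
      \<open>a\<close> is excluded only if sage \<open>i + 1\<close> guesses it against every such
      \<open>c\<close>.\<close>
    have bad: "a \<in> G (Suc i) c b" if a: "a \<in> B" and c: "c \<in> N i a" for a c
    proof (rule ccontr)
      assume *: "a \<notin> G (Suc i) c b"
      from c obtain x where x: "\<forall>j. x j < k" "x i = c" "x (i + 1) = a"
        "\<forall>j\<in>{1..i}. x j \<notin> G j (x (j - 1)) (x (j + 1))"
        by (auto simp: N_def)
      let ?y = "x (Suc (Suc i) := b)"
      have "?y j \<notin> G j (?y (j - 1)) (?y (j + 1))" if j: "j \<in> {1..Suc i}" for j
      proof (cases "j = Suc i")
        case True
        with * x show ?thesis by simp
      next
        case False
        with j have "j \<in> {1..i}" by auto
        with x(4) show ?thesis by auto
      qed
      moreover have "\<forall>j. ?y j < k" using x(1) Suc.prems by simp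
      moreover have "?y (Suc i) = a" "?y (Suc i + 1) = b" using x by auto
      moreover have "a < k" using a by (simp add: B_def)
      ultimately have "a \<in> N (Suc i) b"
        unfolding N_def by blast
      with a show False by (simp add: B_def)
    qed
    have "card B * (2 * t) \<le> (\<Sum>a\<in>B. card (N i a))"
    proof -
      have "(\<Sum>a\<in>B. 2 * t) \<le> (\<Sum>a\<in>B. card (N i a))"
        by (rule sum_mono) (use Suc in \<open>auto simp: B_def\<close>)
      then show ?thesis by simp
    qed
    also have "\<dots> = card (Sigma B (N i))"
      using finB finN by simp
    also have "\<dots> = card ((\<lambda>(a, c). (c, a)) ` Sigma B (N i))"
      by (rule card_image[symmetric]) (auto simp: inj_on_def)
    also have "\<dots> \<le> card (SIGMA c:{..<k}. G (Suc i) c b)"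
    proof (rule card_mono)
      show "finite (SIGMA c:{..<k}. G (Suc i) c b)"
        using G Suc.prems by (intro finite_SigmaI) auto
      show "(\<lambda>(a, c). (c, a)) ` Sigma B (N i) \<subseteq> (SIGMA c:{..<k}. G (Suc i) c b)"
        using bad by (auto simp: N_def)
    qed
    also have "\<dots> = (\<Sum>c<k. card (G (Suc i) c b))"
      using G Suc.prems by simp
    also have "\<dots> \<le> (\<Sum>c<k. t)"
      by (rule sum_mono) (use G Suc.prems in auto)
    finally have "(2 * card B) * t \<le> k * t" by (simp add: mult_ac)
    \<comment> \<open>Integrality matters here: for \<open>k = 4 * t - 1\<close> at most
      \<open>2 * t - 1\<close> colours are excluded, which leaves \<open>2 * t\<close>.\<close>
    then have "2 * card B \<le> k" using t by simp
    moreover have "card B = k - card (N (Suc i) b)"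
      unfolding B_def by (subst card_Diff_subset) (auto simp: finN N_def)
    ultimately show ?case using k t by linarith
  qed
  have "0 < k" using k t by linarith
  with main[of n 0] t have "card (N n 0) \<noteq> 0" by auto
  then have "N n 0 \<noteq> {}" by auto
  then obtain a where "a \<in> N n 0" by auto
  then show ?thesis unfolding N_def by blast
qed

section \<open>Cyclic arcs, and winning on a path with \<open>4 * t - 2\<close> colours\<close>

text \<open>The offset \<open>m * b\<close> makes the arc of \<open>b + 1\<close> begin where the
  arc of \<open>b\<close> stops.\<close>

definition arc :: "nat \<Rightarrow> nat \<Rightarrow> nat \<Rightarrow> nat set" where
  "arc k m b = (\<lambda>j. (m * b + j) mod k) ` {..<m}"

lemma arc_full:
  assumes "a < k"
  shows "a \<in> arc k k b"
  using assms by (auto simp: arc_def image_iff intro!: bexI[of _ a])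

text \<open>The complement of a cyclic arc is the arc that follows it. This lists the colours
  counted in \<open>card_arc_cover\<close> as consecutive residues.\<close>

lemma not_in_arc:
  assumes "a < k" "a \<notin> arc k m b"
  shows "\<exists>j<k - m. a = (m * b + m + j) mod k"
proof -
  define r where "r = (m * b) mod k"
  define u where "u = (a + (k - r)) mod k"
  have "r < k" using assms by (simp add: r_def)
  have "(m * b + u) mod k = (r + (a + (k - r))) mod k"
    unfolding u_def r_def by (metis mod_add_left_eq mod_add_right_eq)
  also have "\<dots> = a"
    using \<open>r < k\<close> assms by simp
  finally have u: "(m * b + u) mod k = a" .
  have "u < k" using assms by (simp add: u_def)
  have "\<not> u < m" using u assms by (auto simp: arc_def)
  with u \<open>u < k\<close> show ?thesis
    by (intro exI[of _ "u - m"]) (auto simp: add.assoc)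
qed

text \<open>The arcs of consecutive colours \<open>a\<close> are adjacent, so \<open>k - m'\<close> consecutive ones
  wind around \<open>\<int>/k\<close> at most \<open>t\<close> times.\<close>

lemma card_arc_cover:
  assumes "0 < m" "(k - m') * m \<le> k * t"
  shows "card {a. a < k \<and> c \<in> arc k m a \<and> a \<notin> arc k m' b} \<le> t"
proof -
  let ?A = "{a. a < k \<and> c \<in> arc k m a \<and> a \<notin> arc k m' b}"
  define e where "e = m' * b + m'"
  \<comment> \<open>If the arc of the colour \<open>e + j\<close> contains \<open>c\<close> at
    position \<open>u\<close>, put \<open>v = m * j + u\<close>. Then \<open>v\<close> determines
    \<open>j\<close> and lies in a fixed residue class modulo \<open>k\<close>, which meets each of
    the \<open>t\<close> blocks of length \<open>k\<close> at most once.\<close>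
  define V where "V = {v. v < k * t \<and> (m * e + v) mod k = c}"
  have "?A \<subseteq> (\<lambda>v. (e + v div m) mod k) ` V"
  proof
    fix a assume a: "a \<in> ?A"
    then obtain j where j: "j < k - m'" "a = (e + j) mod k"
      using not_in_arc[of a k m' b] by (auto simp: e_def)
    from a obtain u where u: "u < m" "c = (m * a + u) mod k" by (auto simp: arc_def)
    have "c = (m * (e + j) + u) mod k"
      unfolding u(2) j(2) by (metis mod_add_left_eq mod_mult_right_eq)
    then have c: "(m * e + (m * j + u)) mod k = c"
      by (simp add: algebra_simps)
    have "m * j + u < m * Suc j" using u by simp
    also have "\<dots> \<le> m * (k - m')" using j by (intro mult_le_mono) auto
    also have "\<dots> \<le> k * t" using assms by (simp add: mult.commute)
    finally have "m * j + u \<in> V" using c by (simp add: V_def)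
    moreover have "(m * j + u) div m = j" using u by simp
    ultimately show "a \<in> (\<lambda>v. (e + v div m) mod k) ` V" using j(2) by force
  qed
  moreover have "finite V" by (simp add: V_def)
  ultimately have "card ?A \<le> card V" by (rule surj_card_le[rotated])
  also have "card V \<le> card {..<t}"
  proof (rule card_inj_on_le)
    show "inj_on (\<lambda>v. v div k) V"
    proof (rule inj_onI)
      fix v w assume vw: "v \<in> V" "w \<in> V" "v div k = w div k"
      then have "(m * e + v) mod k = (m * e + w) mod k" by (simp add: V_def)
      then have "v mod k = w mod k"
        by (simp add: nat_mod_eq_iff)
      with vw show "v = w" by (metis div_mult_mod_eq)
    qed
    show "(\<lambda>v. v div k) ` V \<subseteq> {..<t}"
      by (auto simp: V_def less_mult_imp_div_less mult.commute)
  qed simp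
  finally show ?thesis by simp
qed

lemma path_winning:
  assumes k: "k = 4 * t - 2"
  shows "\<exists>G. (\<forall>i l r. G i l r \<subseteq> {..<k} \<and> card (G i l r) \<le> t) \<and>
    (\<forall>x. (\<forall>j. x j < k) \<longrightarrow> (\<exists>i\<in>{1..k}. x i \<in> G i (x (i - 1)) (x (i + 1))))"
proof -
  \<comment> \<open>Sage \<open>i\<close> trusts that \<open>l\<close> lies in the arc prescribed by
    his own colour, and guesses the colours \<open>a\<close> that would break the corresponding
    statement for \<open>a\<close> and \<open>r\<close>.\<close>
  define G where "G i l r = (if i \<in> {1..k} then
    {a. a < k \<and> l \<in> arc k (k - (i - 1)) a \<and> a \<notin> arc k (k - i) r} else {})" for i l r
  have "card (G i l r) \<le> t" for i l r
  proof (cases "i \<in> {1..k}")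
    case True
    then have t: "t \<ge> 1" using k by auto
    \<comment> \<open>The roots \<open>2 * t - 1\<close> and \<open>2 * t\<close> have sum
      \<open>k + 1\<close> and product \<open>k * t\<close>. They are consecutive, so the quadratic
      is negative at no integer.\<close>
    have "(int i - 2 * int t) * (int i - (2 * int t - 1)) \<ge> 0"
      by (cases "i \<le> 2 * t - 1") (use t in \<open>auto intro: mult_nonneg_nonneg mult_nonpos_nonpos\<close>)
    then have "int i * (int k - (int i - 1)) \<le> int k * int t"
      using k t by (simp add: algebra_simps of_nat_diff)
    moreover have "int (k - (i - 1)) = int k - (int i - 1)" using True by auto
    ultimately have "int (i * (k - (i - 1))) \<le> int (k * t)"
      by (metis of_nat_mult)
    then have "i * (k - (i - 1)) \<le> k * t"
      by (simp only: of_nat_le_iff)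
    moreover have "k - (k - i) = i" "0 < k - (i - 1)" using True by auto
    ultimately show ?thesis
      using True card_arc_cover[of "k - (i - 1)" k "k - i" t l r] by (simp add: G_def)
  next
    case False
    then show ?thesis by (auto simp: G_def)
  qed
  moreover have "\<exists>i\<in>{1..k}. x i \<in> G i (x (i - 1)) (x (i + 1))" if x: "\<forall>j. x j < k" for x
  proof (rule ccontr)
    assume lose: "\<not> ?thesis"
    \<comment> \<open>If all guesses fail, membership passes from the arc of length
      \<open>k\<close>, which is everything, down to the empty arc.\<close>
    have "x i \<in> arc k (k - i) (x (i + 1))" if "i \<le> k" for i
      using that
    proof (induction i)
      case 0
      show ?case using x by (simp add: arc_full)
    next
      case (Suc i)
      then have "Suc i \<in> {1..k}" by simp
      then have "x (Suc i) \<notin> G (Suc i) (x i) (x (Suc i + 1))" using lose by (metis diff_Suc_1)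
      with Suc x show ?case by (simp add: G_def)
    qed
    from this[of k] show False by (simp add: arc_def)
  qed
  ultimately show ?thesis by (intro exI[of _ G]) (auto simp: G_def)
qed

section \<open>Path strategies indexed by the stem colour\<close>

text \<open>Enumerate \<open>A\<close> and cut the enumeration into blocks of length
  \<open>s\<close>. This will distribute \<open>s * (s + 1)\<close> guesses among
  \<open>s + 1\<close> stem colours.\<close>

lemma split_finite_set:
  assumes "finite A" "card A \<le> s * r"
  shows "\<exists>P. (\<forall>j::nat. P j \<subseteq> A \<and> card (P j) \<le> s) \<and> A = (\<Union>j<r. P j)"
proof -
  from assms(1) obtain f where f: "bij_betw f A {0..<card A}"
    using ex_bij_betw_finite_nat by blast
  define P where "P j = {a \<in> A. f a div s = j}" for j
  have "card (P j) \<le> s" for j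
  proof (cases "s = 0")
    case True
    with assms show ?thesis by (simp add: P_def)
  next
    case False
    have "card (P j) \<le> card {j * s..<j * s + s}"
    proof (rule card_inj_on_le)
      show "inj_on f (P j)" using f by (auto simp: P_def bij_betw_def inj_on_def)
      show "f ` P j \<subseteq> {j * s..<j * s + s}"
      proof
        fix y assume "y \<in> f ` P j"
        then have "y div s = j" by (auto simp: P_def)
        with False show "y \<in> {j * s..<j * s + s}"
          using div_mult_mod_eq[of y s] mod_less_divisor[of s y] by (simp; linarith)
      qed
    qed simp
    then show ?thesis by simp
  qed
  moreover have "f a div s < r" if "a \<in> A" for a
    using f that assms(2) by (intro less_mult_imp_div_less)
      (auto simp: bij_betw_def mult.commute dest!: equalityD1)
  ultimately show ?thesis by (intro exI[of _ P]) (auto simp: P_def)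
qed

text \<open>\<open>H i d\<close> is the strategy of path vertex \<open>i\<close> while the stem
  wears \<open>d\<close>, and \<open>M\<close> is the path length required. At most \<open>s\<close>
  stem colours may be left losing, since the stem can list that many.\<close>

lemma family_winning:
  assumes k: "k = 4 * s * (s + 1) - 2"
  shows "\<exists>M H. (\<forall>i d l r. H i d l r \<subseteq> {..<k} \<and> card (H i d l r) \<le> s) \<and>
    (\<forall>x :: nat \<Rightarrow> nat. (\<forall>j. x j < k) \<longrightarrow>
      card {d. d < k \<and> (\<forall>i\<in>{1..M}. x i \<notin> H i d (x (i - 1)) (x (i + 1)))} \<le> s)"
proof -
  have "k = 4 * (s * (s + 1)) - 2" using k by (simp add: mult.assoc)
  then obtain G where G: "\<And>i l r. G i l r \<subseteq> {..<k}" "\<And>i l r. card (G i l r) \<le> s * (s + 1)"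
    and win: "\<And>x. (\<forall>j. x j < k) \<Longrightarrow> \<exists>i\<in>{1..k}. x i \<in> G i (x (i - 1)) (x (i + 1))"
    using path_winning[of k "s * (s + 1)"] by blast
  have "\<forall>i l r. \<exists>P. (\<forall>j::nat. P j \<subseteq> G i l r \<and> card (P j) \<le> s) \<and> G i l r = (\<Union>j<s + 1. P j)"
    using finite_subset[OF G(1)] G(2) by (intro allI split_finite_set) blast+
  then obtain P where P: "\<And>i l r j. P i l r j \<subseteq> G i l r" "\<And>i l r j. card (P i l r j) \<le> s"
    "\<And>i l r. G i l r = (\<Union>j<s + 1. P i l r (j::nat))"
    by metis
  \<comment> \<open>Lists rather than sets: the \<open>j\<close>-th stem colour of a list receives
    the \<open>j\<close>-th part of the guesses.\<close>
  have "finite {ys. set ys \<subseteq> {..<k} \<and> length ys = s + 1 \<and> distinct ys}"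
    by (rule finite_subset[OF _ finite_lists_length_eq[of "{..<k}" "s + 1"]]) auto
  then obtain SS where SS: "set SS = {ys. set ys \<subseteq> {..<k} \<and> length ys = s + 1 \<and> distinct ys}"
    using finite_list[of "{ys. set ys \<subseteq> {..<k} \<and> length ys = s + 1 \<and> distinct ys}"] by auto
  \<comment> \<open>Vertices are numbered from 1, so segment \<open>p\<close> runs from
    \<open>p * k + 1\<close> to \<open>p * k + k\<close>.\<close>
  define seg where "seg i = SS ! ((i - 1) div k)" for i
  define H where "H i d l r = (if (i - 1) div k < length SS
    then \<Union>j\<in>{j. j < s + 1 \<and> seg i ! j = d}. P ((i - 1) mod k + 1) l r j else {})" for i d l r
  have Hsub: "H i d l r \<subseteq> {..<k}" for i d l r
    unfolding H_def using order_trans[OF P(1) G(1)] by (simp add: UN_subset_iff)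
  have Hcard: "card (H i d l r) \<le> s" for i d l r
  proof (cases "(i - 1) div k < length SS \<and> d \<in> set (seg i)")
    case True
    then have "seg i \<in> set SS" by (simp add: seg_def)
    then have ys: "length (seg i) = s + 1" "distinct (seg i)" by (auto simp: SS)
    with True obtain j where "j < s + 1" "seg i ! j = d" by (metis in_set_conv_nth)
    with ys have "{j. j < s + 1 \<and> seg i ! j = d} = {j}"
      by (auto simp: nth_eq_iff_index_eq)
    with True P(2) show ?thesis by (simp add: H_def)
  next
    case False
    have "H i d l r = {}"
    proof (cases "(i - 1) div k < length SS")
      case True
      then have "seg i \<in> set SS" by (simp add: seg_def)
      then have "length (seg i) = s + 1" by (auto simp: SS)
      with True False show ?thesis by (auto simp: H_def)
    qed (simp add: H_def)
    then show ?thesis by simp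
  qed
  have "card {d. d < k \<and> (\<forall>i\<in>{1..length SS * k}. x i \<notin> H i d (x (i - 1)) (x (i + 1)))} \<le> s"
    (is "card ?D \<le> s") if x: "\<forall>j. x j < k" for x
  proof (rule ccontr)
    assume "\<not> ?thesis"
    then have "s + 1 \<le> card ?D" by simp
    then obtain S where S: "S \<subseteq> ?D" "card S = s + 1" "finite S"
      by (rule obtain_subset_with_card_n)
    obtain ys where "set ys = S" "distinct ys"
      using finite_distinct_list[OF S(3)] by auto
    with S(2) have ys: "set ys = S" "distinct ys" "length ys = s + 1"
      by (auto dest: distinct_card)
    then have "ys \<in> set SS" using S by (auto simp: SS)
    then obtain p where p: "p < length SS" "SS ! p = ys" by (metis in_set_conv_nth)
    \<comment> \<open>\<open>G\<close> wins whatever the dummy colours are, so the vertices just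
      outside the segment can take their place.\<close>
    have "\<forall>j. x (p * k + j) < k" using x by simp
    from win[OF this] obtain q where q: "q \<in> {1..k}"
      "x (p * k + q) \<in> G q (x (p * k + (q - 1))) (x (p * k + (q + 1)))" by blast
    then obtain j where j: "j < s + 1"
      "x (p * k + q) \<in> P q (x (p * k + (q - 1))) (x (p * k + (q + 1))) j"
      using P(3) by blast
    let ?i = "p * k + q"
    have i: "?i - 1 = p * k + (q - 1)" "?i + 1 = p * k + (q + 1)" using q by auto
    have "q - 1 < k" using q by auto
    then have "(?i - 1) div k = p" "(?i - 1) mod k = q - 1"
      unfolding i by simp_all
    then have dm: "(?i - 1) div k = p" "(?i - 1) mod k + 1 = q"
      using q by auto
    have "x ?i \<in> H ?i (ys ! j) (x (?i - 1)) (x (?i + 1))"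
      unfolding H_def seg_def dm using p j i by auto
    moreover have "?i \<in> {1..length SS * k}"
    proof -
      have "?i \<le> Suc p * k" using q by simp
      also have "\<dots> \<le> length SS * k" using p by (intro mult_le_mono) auto
      finally show ?thesis using q by auto
    qed
    moreover have "\<forall>i\<in>{1..length SS * k}. x i \<notin> H i (ys ! j) (x (i - 1)) (x (i + 1))"
    proof -
      have "ys ! j \<in> S" using nth_mem[of j ys] j(1) ys by simp
      from subsetD[OF S(1) this] show ?thesis unfolding mem_Collect_eq by (rule conjunct2)
    qed
    ultimately show False by blast
  qed
  with Hsub Hcard show ?thesis by (intro exI[of _ "length SS * k"] exI[of _ H]) blast
qed

section \<open>Petals\<close>

lemma pverts_petal: "pverts (petal n) = insert None (Some ` {..<n})"
  by (simp add: petal_def add_stem_def path_graph_def)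

lemma neighbours_petal_None: "neighbours (petal n) None = Some ` {..<n}"
  by (auto simp: neighbours_def petal_def add_stem_def path_graph_def)

lemma neighbours_petal_Some:
  "i < n \<Longrightarrow> neighbours (petal n) (Some i) = insert None (Some ` {j. j < n \<and> (j = Suc i \<or> i = Suc j)})"
  by (auto simp: neighbours_def petal_def add_stem_def path_graph_def)

lemma restrict_in_colourings:
  "c \<in> colourings A h \<Longrightarrow> B \<subseteq> A \<Longrightarrow> restrict c B \<in> colourings B h"
  by (auto simp: colourings_def PiE_iff)

section \<open>Upper bound for all petals\<close>

text \<open>The adversary uses just the stem colours 0 to \<open>s\<close>: one path colouring
  defeats the path under all of them, and the stem, seeing only that colouring, lists just
  \<open>s\<close> colours.\<close>

lemma petal_not_winning:
  assumes s: "s \<ge> 1" and k: "4 * s * (s + 1) - 1 \<le> k"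
  shows "\<not> hat_game_winning (petal n) (\<lambda>_. k) (\<lambda>_. s)"
proof
  assume "hat_game_winning (petal n) (\<lambda>_. k) (\<lambda>_. s)"
  then obtain \<sigma> where strat: "is_strategy (petal n) (\<lambda>_. k) (\<lambda>_. s) \<sigma>"
    and win: "\<And>c. c \<in> colourings (pverts (petal n)) (\<lambda>_. k) \<Longrightarrow>
      \<exists>v\<in>pverts (petal n). c v \<in> set (\<sigma> v (restrict c (neighbours (petal n) v)))"
    unfolding hat_game_winning_def by blast
  let ?nb = "neighbours (petal n)"
  have sk: "s < k"
  proof -
    have "s + 1 \<le> s * (s + 1)" using s by simp
    with k s show ?thesis unfolding mult.assoc by linarith
  qed
  \<comment> \<open>Path vertex \<open>i\<close> is \<open>Some (i - 1)\<close>, so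
    \<open>Some i\<close> is its right neighbour and any other path neighbour is the left one. At
    the ends \<open>restrict\<close> discards the missing side.\<close>
  define g where "g i d l r = set (\<sigma> (Some (i - 1)) (restrict
    (\<lambda>v. case v of None \<Rightarrow> d | Some j \<Rightarrow> if j = i then r else l) (?nb (Some (i - 1)))))"
    for i d l r
  have gcard: "card (g i d l r) \<le> s" if "i \<in> {1..n}" "d < k" "l < k" "r < k" for i d l r
  proof -
    have "restrict (\<lambda>v. case v of None \<Rightarrow> d | Some j \<Rightarrow> if j = i then r else l) (?nb (Some (i - 1)))
        \<in> colourings (?nb (Some (i - 1))) (\<lambda>_. k)"
      using that by (auto simp: colourings_def split: option.split)
    moreover have "Some (i - 1) \<in> pverts (petal n)" using that by (auto simp: pverts_petal)
    ultimately show ?thesis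
      using strat unfolding is_strategy_def g_def by (metis card_length)
  qed
  have "\<exists>x. (\<forall>j. x j < k) \<and> (\<forall>i\<in>{1..n}. x i \<notin> (\<Union>d\<le>s. g i d (x (i - 1)) (x (i + 1))))"
  proof (rule path_losing)
    fix i l r assume "l < k" "r < k" "i \<in> {1..n}"
    then have "card (\<Union>d\<le>s. g i d l r) \<le> (\<Sum>d\<le>s. s)"
      using sk by (intro order_trans[OF card_UN_le] sum_mono gcard) auto
    then show "finite (\<Union>d\<le>s. g i d l r) \<and> card (\<Union>d\<le>s. g i d l r) \<le> s * (s + 1)"
      by (simp add: g_def mult.commute)
  qed (use s k in \<open>simp_all add: mult.assoc\<close>)
  then obtain x where x: "\<And>j. x j < k"
    "\<And>i d. i \<in> {1..n} \<Longrightarrow> d \<le> s \<Longrightarrow> x i \<notin> g i d (x (i - 1)) (x (i + 1))"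
    by blast
  define c where "c d = restrict (\<lambda>v. case v of None \<Rightarrow> d | Some j \<Rightarrow> x (j + 1)) (pverts (petal n))" for d
  have c: "c d \<in> colourings (pverts (petal n)) (\<lambda>_. k)" if "d \<le> s" for d
    using x(1) that sk by (auto simp: c_def colourings_def split: option.split)
  \<comment> \<open>The colourings \<open>c d\<close> agree off the stem, so the stem answers
    \<open>L\<close> to each of them.\<close>
  define L where "L = \<sigma> None (restrict (c 0) (?nb None))"
  have "restrict (c 0) (?nb None) \<in> colourings (?nb None) (\<lambda>_. k)"
    using c[of 0] by (rule restrict_in_colourings) (auto simp: neighbours_petal_None pverts_petal)
  then have "length L = s"
    using strat unfolding is_strategy_def L_def by (simp add: pverts_petal)
  then have "card (set L) < card {..s}" using card_length[of L] by simp
  then have "\<not> {..s} \<subseteq> set L" by (metis List.finite_set card_mono not_le)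
  then obtain d where d: "d \<le> s" "d \<notin> set L" by auto
  from win[OF c[OF d(1)]] consider
      "c d None \<in> set (\<sigma> None (restrict (c d) (?nb None)))"
    | i where "i < n" "c d (Some i) \<in> set (\<sigma> (Some i) (restrict (c d) (?nb (Some i))))"
    by (auto simp: pverts_petal)
  then show False
  proof cases
    case 1
    have "restrict (c d) (?nb None) = restrict (c 0) (?nb None)"
      by (auto simp: restrict_def neighbours_petal_None c_def pverts_petal fun_eq_iff)
    moreover have "c d None = d" by (simp add: c_def pverts_petal)
    ultimately show False using 1 d by (simp add: L_def)
  next
    case (2 i)
    have "restrict (c d) (?nb (Some i)) = restrict
      (\<lambda>v. case v of None \<Rightarrow> d | Some j \<Rightarrow> if j = Suc i then x (Suc (Suc i)) else x i) (?nb (Some i))"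
      using 2(1) by (auto simp: restrict_def neighbours_petal_Some c_def pverts_petal fun_eq_iff)
    moreover have "c d (Some i) = x (Suc i)" using 2(1) by (simp add: c_def pverts_petal)
    ultimately have "x (Suc i) \<in> g (Suc i) d (x i) (x (Suc (Suc i)))"
      using 2(2) by (simp add: g_def)
    with x(2)[of "Suc i" d] 2(1) d(1) show False by simp
  qed
qed

section \<open>Lower bound for long petals\<close>

text \<open>A strategy must return exactly \<open>s\<close> entries, so smaller guess sets are
  padded with the colour 0.\<close>

lemma list_of_length_covering:
  fixes k :: nat
  assumes "A \<subseteq> {..<k}" "card A \<le> s" "0 < k"
  shows "\<exists>xs. length xs = s \<and> set xs \<subseteq> {..<k} \<and> A \<subseteq> set xs"
proof -
  obtain ys where ys: "set ys = A" "distinct ys"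
    using finite_distinct_list[OF finite_subset[OF assms(1) finite_lessThan]] by auto
  then have "length ys \<le> s" using assms by (metis distinct_card)
  with ys assms show ?thesis
    by (intro exI[of _ "ys @ replicate (s - length ys) 0"]) (auto simp: set_replicate_conv_if)
qed

lemma petal_winning:
  assumes s: "s \<ge> 1" and k: "k = 4 * s * (s + 1) - 2"
  shows "\<exists>N. \<forall>n\<ge>N. n \<ge> 1 \<longrightarrow> hat_game_winning (petal n) (\<lambda>_. k) (\<lambda>_. s)"
proof -
  obtain M H where H: "\<And>i d l r. H i d l r \<subseteq> {..<k}" "\<And>i d l r. card (H i d l r) \<le> s"
    and lose: "\<And>x :: nat \<Rightarrow> nat. (\<forall>j. x j < k) \<Longrightarrow>
      card {d. d < k \<and> (\<forall>i\<in>{1..M}. x i \<notin> H i d (x (i - 1)) (x (i + 1)))} \<le> s"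
    using family_winning[OF k] by blast
  have k0: "0 < k"
  proof -
    have "1 \<le> s * (s + 1)" using s by simp
    then show ?thesis unfolding k mult.assoc by linarith
  qed
  define lst where "lst A = (SOME xs. length xs = s \<and> set xs \<subseteq> {..<k} \<and> A \<subseteq> set xs)" for A
  have lst: "length (lst A) = s" "set (lst A) \<subseteq> {..<k}" "A \<subseteq> set (lst A)"
    if "A \<subseteq> {..<k}" "card A \<le> s" for A
    using someI_ex[OF list_of_length_covering[OF that k0]] by (simp_all add: lst_def)
  have "hat_game_winning (petal n) (\<lambda>_. k) (\<lambda>_. s)" if n: "n \<ge> M" for n
  proof -
    let ?nb = "neighbours (petal n)"
    \<comment> \<open>The dummies get the constant 0, so that the sages at the ends know their
      value.\<close>
    define ext where "ext c j = (if j \<in> {1..n} then c (Some (j - 1)) else 0)"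
      for c :: "nat option \<Rightarrow> nat" and j
    define D where "D x = {d. d < k \<and> (\<forall>i\<in>{1..M}. x i \<notin> H i d (x (i - 1)) (x (i + 1)))}" for x
    define \<sigma> where "\<sigma> v c = (case v of None \<Rightarrow> lst (D (ext c))
      | Some i \<Rightarrow> lst (H (i + 1) (c None) (ext c i) (ext c (i + 2))))" for v c
    have extk: "ext c j < k" if c: "c \<in> colourings A (\<lambda>_. k)" and A: "Some ` {..<n} \<subseteq> A" for c j A
    proof (cases "j \<in> {1..n}")
      case True
      then have "Some (j - 1) \<in> A" using A by auto
      with c have "c (Some (j - 1)) \<in> {..<k}" unfolding colourings_def by (rule PiE_mem)
      with True show ?thesis by (simp add: ext_def)
    next
      case False
      with k0 show ?thesis by (auto simp: ext_def)
    qed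
    have D: "D (ext c) \<subseteq> {..<k}" "card (D (ext c)) \<le> s"
      if "c \<in> colourings A (\<lambda>_. k)" "Some ` {..<n} \<subseteq> A" for c A
      using lose[of "ext c"] extk[OF that] by (auto simp: D_def)
    have "is_strategy (petal n) (\<lambda>_. k) (\<lambda>_. s) \<sigma>"
      unfolding is_strategy_def
    proof (intro ballI)
      fix v c assume "v \<in> pverts (petal n)" "c \<in> colourings (?nb v) (\<lambda>_. k)"
      then show "length (\<sigma> v c) = s \<and> set (\<sigma> v c) \<subseteq> {..<k}"
        using lst[OF D, of c "Some ` {..<n}"] lst[OF H]
        by (cases v) (auto simp: \<sigma>_def neighbours_petal_None)
    qed
    moreover have "\<exists>v\<in>pverts (petal n). c v \<in> set (\<sigma> v (restrict c (?nb v)))"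
      if c: "c \<in> colourings (pverts (petal n)) (\<lambda>_. k)" for c
    proof (cases "c None \<in> D (ext c)")
      case True
      have "ext (restrict c (?nb None)) = ext c"
        by (auto simp: ext_def neighbours_petal_None fun_eq_iff)
      with True lst(3)[OF D[OF c]] have "c None \<in> set (\<sigma> None (restrict c (?nb None)))"
        by (auto simp: \<sigma>_def pverts_petal)
      then show ?thesis by (auto simp: pverts_petal)
    next
      case False
      moreover have "c None < k" using c by (auto simp: colourings_def pverts_petal)
      ultimately obtain i where i: "i \<in> {1..M}"
        "ext c i \<in> H i (c None) (ext c (i - 1)) (ext c (i + 1))"
        by (auto simp: D_def)
      then obtain j where j: "i = Suc j" "j < n" using n by (cases i) auto
      \<comment> \<open>\<open>Some j\<close> is path vertex \<open>j + 1\<close>; what he sees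
        determines every argument of \<open>H\<close>.\<close>
      have eq: "restrict c (?nb (Some j)) None = c None"
        "ext (restrict c (?nb (Some j))) j = ext c j"
        "ext (restrict c (?nb (Some j))) (j + 2) = ext c (j + 2)"
        using j by (auto simp: ext_def neighbours_petal_Some)
      have "c (Some j) \<in> H (j + 1) (c None) (ext c j) (ext c (j + 2))"
        using i j by (simp add: ext_def)
      then have "c (Some j) \<in> set (\<sigma> (Some j) (restrict c (?nb (Some j))))"
        unfolding \<sigma>_def option.case eq using lst(3)[OF H] by blast
      then show ?thesis using j by (auto simp: pverts_petal)
    qed
    ultimately show ?thesis unfolding hat_game_winning_def by blast
  qed
  then show ?thesis by blast
qed

theorem theorem3p8:
  fixes s :: nat
  assumes "s \<ge> 1"
  shows "HG_class s petals = enat (4 * s * (s + 1) - 2)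
    \<and> (\<forall>n\<ge>1. HG s (petal n) < enat (4 * s * (s + 1) - 1))
    \<and> (\<exists>N. \<forall>n\<ge>N. n \<ge> 1 \<longrightarrow> HG s (petal n) = enat (4 * s * (s + 1) - 2))"
proof -
  let ?K = "4 * s * (s + 1) - 2"
  have K: "?K < 4 * s * (s + 1) - 1"
  proof -
    have "1 \<le> s * (s + 1)" using assms by simp
    then show ?thesis unfolding mult.assoc by linarith
  qed
  \<comment> \<open>Every \<open>k\<close> beyond \<open>?K\<close> loses, so the supremum over the
    winning \<open>k\<close> is at most \<open>?K\<close>.\<close>
  have upper: "HG s (petal n) \<le> enat ?K" for n
    unfolding HG_def
  proof (rule SUP_least)
    fix k assume "k \<in> {k. hat_game_winning (petal n) (\<lambda>_. k) (\<lambda>_. s)}"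
    then have "\<not> 4 * s * (s + 1) - 1 \<le> k" using petal_not_winning[OF assms] by blast
    then show "enat k \<le> enat ?K" by simp
  qed
  obtain N where N: "\<And>n. n \<ge> N \<Longrightarrow> n \<ge> 1 \<Longrightarrow> hat_game_winning (petal n) (\<lambda>_. ?K) (\<lambda>_. s)"
    using petal_winning[OF assms refl] by blast
  have eq: "HG s (petal n) = enat ?K" if "n \<ge> N" "n \<ge> 1" for n
  proof (rule antisym[OF upper])
    show "enat ?K \<le> HG s (petal n)"
      unfolding HG_def by (rule SUP_upper) (use N[OF that] in simp)
  qed
  have "HG_class s petals = enat ?K"
  proof (rule antisym)
    show "HG_class s petals \<le> enat ?K"
      unfolding HG_class_def by (rule SUP_least) (auto simp: petals_def upper simp del: One_nat_def)
    have "petal (max N 1) \<in> petals" by (auto simp: petals_def)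
    then have "HG s (petal (max N 1)) \<le> HG_class s petals"
      unfolding HG_class_def by (rule SUP_upper)
    then show "enat ?K \<le> HG_class s petals" using eq[of "max N 1"] by simp
  qed
  moreover have "HG s (petal n) < enat (4 * s * (s + 1) - 1)" for n
    using upper[of n] K by (metis enat_ord_simps(2) le_less_trans)
  ultimately show ?thesis using eq by blast
qed

end
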